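(* Let $V_{\mathrm{orig}}$ be the globally optimal value of the original profit-maximization problem (P), and let $V_{\mathrm{rel}}$ be the globally optimal value of the relaxed problem (R), where (P) and (R) are as defined in the context and share the same data and corresponding initial states. Then the globally optimal value of the relaxed problem is an upper bound for the original problem: $V_{\mathrm{rel}} \ge V_{\mathrm{orig}}$.
   Context: **Data.** $\mathcal{K}=\{1,\dots,K\}$ is a finite set of zones ($K\ge 2$) and $\mathcal{T}=[0,T]$ is the operation horizon. The following are given. - Trip times $\tau_{ij}>0$ for $i,j\in\mathcal{K}$, including $i=j$, constant in time. - Exogenous travel demands $\bar q_{ij}(t)\ge 0$ (bounded and measurable in $t$) with $\sum_{j}\bar q_{ij}(t)>0$ for all $i,t$. - Total fleet size $N>0$ and operational cost $\gamma\ge 0$ per vehicle per unit time. - Demand parameters $\epsilon,\alpha>0$; pickup parameters $\beta_i>0$, $\theta_i>0$; completion parameter $\kappa>0$; cancellation parameters $c_0\in\mathbb{R}$, $c_1>0$, $c_2<0$. - Idle-vehicle threshold $N^v_{\mathrm{lb}}>0$, price cap $p_{\mathrm{ub}}>0$, and parking capacities $N^p_{\mathrm{ub},i}(t)\ge 0$. - Control update period $T_c>0$. A trajectory is "step-wise" if it is constant on each interval $[kT_c,(k+1)T_c)$, $k=0,1,2,\dots$, intersected with $\mathcal{T}$. Differential equations are understood for absolutely continuous states and almost every $t$. **Flow functions** (used in both problems). Given price $p_i(t)$, number of idle vehicles $N^v_i(t)$, waiting passengers $Q^w_i(t)$ and matched passengers $Q^m_i(t)$, set $$w_i(t)=\frac{1}{\beta_i}[N^v_i(t)]^{-\theta_i},\qquad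 q_{ij}(t)=\bar q_{ij}(t)\,e^{-\epsilon(\alpha w_i(t)+p_i(t)\tau_{ij})},$$ $$m_{ij}(t)=\frac{q_{ij}(t)}{\sum_{k\in\mathcal{K}}q_{ik}(t)}\min\Big(Q^w_i(t),\max\big(N^v_i(t)-N^v_{\mathrm{lb}},0\big)\Big),$$ $$\tilde m_i(t)=\min\Big(Q^w_i(t),\max\big(0,\,c_0+c_1Q^w_i(t)+c_2N^v_i(t)\big)\Big),$$ $$b_{ij}(t)=\frac{q_{ij}(t)}{\sum_{k\in\mathcal{K}}q_{ik}(t)}\,\beta_i\,Q^m_i(t)\,[N^v_i(t)]^{\theta_i}.$$ **Original problem (P).** The states are $Q^w_i$ (waiting passengers), $Q^m_i$ (matched passengers), $Q^b_{ij}$ (en-route passengers), $N^v_i$ (idle vehicles), $N^r_{ij}$ (relocating vehicles) and $N^p_i$ (parked, off-duty vehicles). All are real-valued. The controls are the step-wise trajectories $\mathbf{p}=(p_i)$ (prices), $\mathbf{r}=(r_{ij})$ (rebalancing flows) and $\mathbf{s}=(s_i)$ (fleet size adjustments, of either sign). The numbers of matched and occupied vehicles are $N^m_i=Q^m_i$ and $N^b_{ij}=Q^b_{ij}$. With $\tilde q_{ij}(t)=\frac{\kappa}{\tau_{ij}}Q^b_{ij}(t)$ and $\tilde r_{ij}(t)=\frac{\kappa}{\tau_{ij}}N^r_{ij}(t)$, the dynamics are $$\dot Q^w_i=\sum_{j}q_{ij}-\sum_j m_{ij}-\tilde m_i,\qquad \dot Q^m_i=\sum_j m_{ij}-\sum_j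 b_{ij},\qquad \dot Q^b_{ij}=b_{ij}-\tilde q_{ij},$$ $$\dot N^v_i=s_i+\sum_j\tilde q_{ji}+\sum_j\tilde r_{ji}-\sum_j m_{ij}-\sum_j r_{ij},\qquad \dot N^r_{ij}=r_{ij}-\tilde r_{ij},\qquad \dot N^p_i=-s_i.$$ They start from a given nonnegative initial state satisfying the vehicle conservation law, which the dynamics then preserve for all $t$: $$N=\sum_i N^v_i+\sum_i Q^m_i+\sum_{i,j}Q^b_{ij}+\sum_{i,j}N^r_{ij}+\sum_i N^p_i.$$ Problem (P) is to maximize over $\mathbf{p},\mathbf{r},\mathbf{s}$ $$\int_{\mathcal{T}}\Big[\sum_{i}\sum_{j}m_{ij}(t)p_i(t)\tau_{ij}-\gamma N^{\mathrm{on}}(t)\Big]dt,\qquad N^{\mathrm{on}}(t)=N-\sum_iN^p_i(t),$$ subject to the dynamics and, for all $i,j,t$: $r_{ij}(t)\ge0$; $0\le p_i(t)\le p_{\mathrm{ub}}$; $N^v_i(t)\ge N^v_{\mathrm{lb}}$; $0\le N^p_i(t)\le N^p_{\mathrm{ub},i}(t)$; $Q^w_i(t),Q^m_i(t),Q^b_{ij}(t),N^b_{ij}(t)\ge0$. **Relaxed problem (R).** The states are $Q^w_i,Q^m_i,Q^{\mathrm{intra}}_i,Q^{\mathrm{inter}}_i$. The decisions are step-wise prices $\mathbf{p}=(p_i)$ and idle-vehicle trajectories $\mathbf{N}^v=(N^v_i)$. The functions $N^v_i$ may be chosen freely at every instant (bounded measurable functions of $t$, not required to be step-wise and not governed by any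 dynamics). Put $\bar\tau_i=\min_{j\in\mathcal{K}\setminus\{i\}}\tau_{ij}$, $\tilde q^{\mathrm{intra}}_i=\frac{\kappa}{\tau_{ii}}Q^{\mathrm{intra}}_i$ and $\tilde q^{\mathrm{inter}}_i=\frac{\kappa}{\bar\tau_i}Q^{\mathrm{inter}}_i$. The dynamics are $$\dot Q^w_i=\sum_jq_{ij}-\sum_jm_{ij}-\tilde m_i,\qquad \dot Q^m_i=\sum_jm_{ij}-\sum_jb_{ij},$$ $$\dot Q^{\mathrm{intra}}_i=b_{ii}-\tilde q^{\mathrm{intra}}_i,\qquad \dot Q^{\mathrm{inter}}_i=\sum_{j\in\mathcal{K}\setminus\{i\}}b_{ij}-\tilde q^{\mathrm{inter}}_i.$$ The initial values of $Q^w_i,Q^m_i$ are the same as in (P), and $Q^{\mathrm{intra}}_i(0)=Q^b_{ii}(0)$, $Q^{\mathrm{inter}}_i(0)=\sum_{j\in\mathcal{K}\setminus\{i\}}Q^b_{ij}(0)$. Problem (R) is to maximize over $\mathbf{p},\mathbf{N}^v$ $$\int_{\mathcal{T}}\Big[\sum_{i}\sum_{j}m_{ij}(t)p_i(t)\tau_{ij}-\gamma N^{\mathrm{on}}(t)\Big]dt,\qquad N^{\mathrm{on}}(t)=\sum_i\big[N^v_i(t)+Q^m_i(t)+Q^{\mathrm{intra}}_i(t)+Q^{\mathrm{inter}}_i(t)\big],$$ subject to these dynamics and, for all $i,t$: $0\le p_i(t)\le p_{\mathrm{ub}}$; $N^v_i(t)\ge N^v_{\mathrm{lb}}$; $Q^w_i(t),Q^m_i(t),Q^{\mathrm{intra}}_i(t),Q^{\mathrm{inter}}_i(t)\ge0$;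 $N-N^{\mathrm{on}}(t)\ge0$. "Globally optimal value" means the supremum of the objective over all feasible decisions (with value $-\infty$ if there are none). *)

theory Defs
  imports "HOL-Analysis.Analysis"
begin

(* Zones are the elements of a finite type 'z, so K = CARD('z). *)

record 'z fleet_data =
  horizon :: real
  trip_time :: "'z \<Rightarrow> 'z \<Rightarrow> real"
  demand :: "'z \<Rightarrow> 'z \<Rightarrow> real \<Rightarrow> real"
  fleet_size :: real
  op_cost :: real
  demand_sens :: real      (* \<epsilon> *)
  wait_weight :: real      (* \<alpha> *)
  pickup_coeff :: "'z \<Rightarrow> real"   (* \<beta> *)
  pickup_exp :: "'z \<Rightarrow> real"     (* \<theta> *)
  completion_rate :: real  (* \<kappa> *)
  cancel0 :: real
  cancel1 :: real
  cancel2 :: real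
  idle_lb :: real
  price_ub :: real
  park_ub :: "'z \<Rightarrow> real \<Rightarrow> real"
  ctrl_period :: real

record 'z initial_state =
  init_Qw :: "'z \<Rightarrow> real"
  init_Qm :: "'z \<Rightarrow> real"
  init_Qb :: "'z \<Rightarrow> 'z \<Rightarrow> real"
  init_Nv :: "'z \<Rightarrow> real"
  init_Nr :: "'z \<Rightarrow> 'z \<Rightarrow> real"
  init_Np :: "'z \<Rightarrow> real"

abbreviation times :: "'z fleet_data \<Rightarrow> real set" where
  "times D \<equiv> {0..horizon D}"

definition valid_data :: "('z::finite) fleet_data \<Rightarrow> bool" where
  "valid_data D \<longleftrightarrow>
     0 \<le> horizon D \<and>
     (\<forall>i j. 0 < trip_time D i j) \<and>
     (\<forall>i j. \<forall>t\<in>times D. 0 \<le> demand D i j t) \<and>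
     (\<forall>i j. bounded (demand D i j ` times D)) \<and>
     (\<forall>i j. demand D i j \<in> borel_measurable (lebesgue_on (times D))) \<and>
     (\<forall>i. \<forall>t\<in>times D. 0 < (\<Sum>j\<in>UNIV. demand D i j t)) \<and>
     0 < fleet_size D \<and> 0 \<le> op_cost D \<and>
     0 < demand_sens D \<and> 0 < wait_weight D \<and>
     (\<forall>i. 0 < pickup_coeff D i) \<and> (\<forall>i. 0 < pickup_exp D i) \<and>
     0 < completion_rate D \<and>
     0 < cancel1 D \<and> cancel2 D < 0 \<and>
     0 < idle_lb D \<and> 0 < price_ub D \<and>
     (\<forall>i. \<forall>t\<in>times D. 0 \<le> park_ub D i t) \<and>
     0 < ctrl_period D"

definition valid_initial :: "('z::finite) fleet_data \<Rightarrow> 'z initial_state \<Rightarrow> bool" where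
  "valid_initial D X \<longleftrightarrow>
     (\<forall>i. 0 \<le> init_Qw X i) \<and> (\<forall>i. 0 \<le> init_Qm X i) \<and> (\<forall>i j. 0 \<le> init_Qb X i j) \<and>
     (\<forall>i. 0 \<le> init_Nv X i) \<and> (\<forall>i j. 0 \<le> init_Nr X i j) \<and> (\<forall>i. 0 \<le> init_Np X i) \<and>
     fleet_size D = (\<Sum>i\<in>UNIV. init_Nv X i) + (\<Sum>i\<in>UNIV. init_Qm X i)
       + (\<Sum>i\<in>UNIV. \<Sum>j\<in>UNIV. init_Qb X i j) + (\<Sum>i\<in>UNIV. \<Sum>j\<in>UNIV. init_Nr X i j)
       + (\<Sum>i\<in>UNIV. init_Np X i)"

definition stepwise :: "'z fleet_data \<Rightarrow> (real \<Rightarrow> real) \<Rightarrow> bool" where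
  "stepwise D f \<longleftrightarrow>
     (\<forall>k::nat. f constant_on ({real k * ctrl_period D..<real (k + 1) * ctrl_period D} \<inter> times D))"

(* A pair (u, v) in S stands for the interval [u, v]; the intervals may only share end points. *)
definition abs_continuous_on_Icc :: "real \<Rightarrow> real \<Rightarrow> (real \<Rightarrow> real) \<Rightarrow> bool" where
  "abs_continuous_on_Icc a b f \<longleftrightarrow>
     (\<forall>e>0. \<exists>d>0. \<forall>S :: (real \<times> real) set.
        finite S \<and> (\<forall>(u, v)\<in>S. a \<le> u \<and> u \<le> v \<and> v \<le> b) \<and>
        pairwise (\<lambda>(u, v) (u', v'). disjnt {u<..<v} {u'<..<v'}) S \<and>
        (\<Sum>(u, v)\<in>S. v - u) < d
        \<longrightarrow> (\<Sum>(u, v)\<in>S. \<bar>f v - f u\<bar>) < e)"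

definition solves_ode :: "'z fleet_data \<Rightarrow> (real \<Rightarrow> real) \<Rightarrow> real \<Rightarrow> (real \<Rightarrow> real) \<Rightarrow> bool" where
  "solves_ode D x x0 rhs \<longleftrightarrow>
     abs_continuous_on_Icc 0 (horizon D) x \<and> x 0 = x0 \<and>
     (AE t in lebesgue_on (times D). (x has_real_derivative rhs t) (at t within times D))"

type_synonym 'z traj = "'z \<Rightarrow> real \<Rightarrow> real"
type_synonym 'z traj2 = "'z \<Rightarrow> 'z \<Rightarrow> real \<Rightarrow> real"

definition wait_time :: "'z fleet_data \<Rightarrow> 'z traj \<Rightarrow> 'z traj" where
  "wait_time D Nv i t = 1 / pickup_coeff D i * Nv i t powr (- pickup_exp D i)"

definition request_rate :: "'z fleet_data \<Rightarrow> 'z traj \<Rightarrow> 'z traj \<Rightarrow> 'z traj2" where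
  "request_rate D p Nv i j t = demand D i j t *
     exp (- demand_sens D * (wait_weight D * wait_time D Nv i t + p i t * trip_time D i j))"

definition match_rate ::
  "('z::finite) fleet_data \<Rightarrow> 'z traj \<Rightarrow> 'z traj \<Rightarrow> 'z traj \<Rightarrow> 'z traj2" where
  "match_rate D p Nv Qw i j t =
     request_rate D p Nv i j t / (\<Sum>k\<in>UNIV. request_rate D p Nv i k t) *
     min (Qw i t) (max (Nv i t - idle_lb D) 0)"

definition cancel_rate :: "'z fleet_data \<Rightarrow> 'z traj \<Rightarrow> 'z traj \<Rightarrow> 'z traj" where
  "cancel_rate D Nv Qw i t =
     min (Qw i t) (max 0 (cancel0 D + cancel1 D * Qw i t + cancel2 D * Nv i t))"

definition board_rate ::
  "('z::finite) fleet_data \<Rightarrow> 'z traj \<Rightarrow> 'z traj \<Rightarrow> 'z traj \<Rightarrow> 'z traj2" where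
  "board_rate D p Nv Qm i j t =
     request_rate D p Nv i j t / (\<Sum>k\<in>UNIV. request_rate D p Nv i k t) *
     (pickup_coeff D i * Qm i t * Nv i t powr pickup_exp D i)"

definition arrival_rate :: "'z fleet_data \<Rightarrow> 'z traj2 \<Rightarrow> 'z traj2" where
  "arrival_rate D Y i j t = completion_rate D / trip_time D i j * Y i j t"

definition revenue_rate ::
  "('z::finite) fleet_data \<Rightarrow> 'z traj \<Rightarrow> 'z traj \<Rightarrow> 'z traj \<Rightarrow> real \<Rightarrow> real" where
  "revenue_rate D p Nv Qw t =
     (\<Sum>i\<in>UNIV. \<Sum>j\<in>UNIV. match_rate D p Nv Qw i j t * p i t * trip_time D i j)"

definition online_orig :: "('z::finite) fleet_data \<Rightarrow> 'z traj \<Rightarrow> real \<Rightarrow> real" where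
  "online_orig D Np t = fleet_size D - (\<Sum>i\<in>UNIV. Np i t)"

definition profit_orig ::
  "('z::finite) fleet_data \<Rightarrow> 'z traj \<Rightarrow> 'z traj \<Rightarrow> 'z traj \<Rightarrow> 'z traj \<Rightarrow> real" where
  "profit_orig D p Nv Qw Np =
     (LINT t|lebesgue_on (times D). revenue_rate D p Nv Qw t - op_cost D * online_orig D Np t)"

(* The matched and occupied vehicle counts coincide with the passenger counts Qm and Qb,
   so nonnegativity of the latter covers both. *)
definition feasible_orig ::
  "('z::finite) fleet_data \<Rightarrow> 'z initial_state \<Rightarrow>
   'z traj \<Rightarrow> 'z traj2 \<Rightarrow> 'z traj \<Rightarrow>
   'z traj \<Rightarrow> 'z traj \<Rightarrow> 'z traj2 \<Rightarrow> 'z traj \<Rightarrow> 'z traj2 \<Rightarrow> 'z traj \<Rightarrow> bool" where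
  "feasible_orig D X p r s Qw Qm Qb Nv Nr Np \<longleftrightarrow>
     (\<forall>i. stepwise D (p i)) \<and> (\<forall>i j. stepwise D (r i j)) \<and> (\<forall>i. stepwise D (s i)) \<and>
     (\<forall>i. solves_ode D (Qw i) (init_Qw X i)
        (\<lambda>t. (\<Sum>j\<in>UNIV. request_rate D p Nv i j t) - (\<Sum>j\<in>UNIV. match_rate D p Nv Qw i j t)
             - cancel_rate D Nv Qw i t)) \<and>
     (\<forall>i. solves_ode D (Qm i) (init_Qm X i)
        (\<lambda>t. (\<Sum>j\<in>UNIV. match_rate D p Nv Qw i j t) - (\<Sum>j\<in>UNIV. board_rate D p Nv Qm i j t))) \<and>
     (\<forall>i j. solves_ode D (Qb i j) (init_Qb X i j)
        (\<lambda>t. board_rate D p Nv Qm i j t - arrival_rate D Qb i j t)) \<and>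
     (\<forall>i. solves_ode D (Nv i) (init_Nv X i)
        (\<lambda>t. s i t + (\<Sum>j\<in>UNIV. arrival_rate D Qb j i t) + (\<Sum>j\<in>UNIV. arrival_rate D Nr j i t)
             - (\<Sum>j\<in>UNIV. match_rate D p Nv Qw i j t) - (\<Sum>j\<in>UNIV. r i j t))) \<and>
     (\<forall>i j. solves_ode D (Nr i j) (init_Nr X i j)
        (\<lambda>t. r i j t - arrival_rate D Nr i j t)) \<and>
     (\<forall>i. solves_ode D (Np i) (init_Np X i) (\<lambda>t. - s i t)) \<and>
     (\<forall>t\<in>times D.
        (\<forall>i j. 0 \<le> r i j t) \<and>
        (\<forall>i. 0 \<le> p i t \<and> p i t \<le> price_ub D) \<and>
        (\<forall>i. idle_lb D \<le> Nv i t) \<and>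
        (\<forall>i. 0 \<le> Np i t \<and> Np i t \<le> park_ub D i t) \<and>
        (\<forall>i. 0 \<le> Qw i t) \<and> (\<forall>i. 0 \<le> Qm i t) \<and> (\<forall>i j. 0 \<le> Qb i j t))"

(* The supremum is taken in the extended reals, where the empty set has supremum - \<infinity>. *)
definition V_orig :: "('z::finite) fleet_data \<Rightarrow> 'z initial_state \<Rightarrow> ereal" where
  "V_orig D X = Sup {ereal (profit_orig D p Nv Qw Np) | p r s Qw Qm Qb Nv Nr Np.
                       feasible_orig D X p r s Qw Qm Qb Nv Nr Np}"

definition min_inter_time :: "('z::finite) fleet_data \<Rightarrow> 'z \<Rightarrow> real" where
  "min_inter_time D i = (MIN j\<in>UNIV - {i}. trip_time D i j)"

definition online_rel ::
  "('z::finite) traj \<Rightarrow> 'z traj \<Rightarrow> 'z traj \<Rightarrow> 'z traj \<Rightarrow> real \<Rightarrow> real" where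
  "online_rel Nv Qm Qintra Qinter t = (\<Sum>i\<in>UNIV. Nv i t + Qm i t + Qintra i t + Qinter i t)"

definition profit_rel ::
  "('z::finite) fleet_data \<Rightarrow> 'z traj \<Rightarrow> 'z traj \<Rightarrow>
   'z traj \<Rightarrow> 'z traj \<Rightarrow> 'z traj \<Rightarrow> 'z traj \<Rightarrow> real" where
  "profit_rel D p Nv Qw Qm Qintra Qinter =
     (LINT t|lebesgue_on (times D).
        revenue_rate D p Nv Qw t - op_cost D * online_rel Nv Qm Qintra Qinter t)"

definition feasible_rel ::
  "('z::finite) fleet_data \<Rightarrow> 'z initial_state \<Rightarrow> 'z traj \<Rightarrow> 'z traj \<Rightarrow>
   'z traj \<Rightarrow> 'z traj \<Rightarrow> 'z traj \<Rightarrow> 'z traj \<Rightarrow> bool" where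
  "feasible_rel D X p Nv Qw Qm Qintra Qinter \<longleftrightarrow>
     (\<forall>i. stepwise D (p i)) \<and>
     (\<forall>i. bounded (Nv i ` times D) \<and> Nv i \<in> borel_measurable (lebesgue_on (times D))) \<and>
     (\<forall>i. solves_ode D (Qw i) (init_Qw X i)
        (\<lambda>t. (\<Sum>j\<in>UNIV. request_rate D p Nv i j t) - (\<Sum>j\<in>UNIV. match_rate D p Nv Qw i j t)
             - cancel_rate D Nv Qw i t)) \<and>
     (\<forall>i. solves_ode D (Qm i) (init_Qm X i)
        (\<lambda>t. (\<Sum>j\<in>UNIV. match_rate D p Nv Qw i j t) - (\<Sum>j\<in>UNIV. board_rate D p Nv Qm i j t))) \<and>
     (\<forall>i. solves_ode D (Qintra i) (init_Qb X i i)
        (\<lambda>t. board_rate D p Nv Qm i i t - completion_rate D / trip_time D i i * Qintra i t)) \<and>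
     (\<forall>i. solves_ode D (Qinter i) (\<Sum>j\<in>UNIV - {i}. init_Qb X i j)
        (\<lambda>t. (\<Sum>j\<in>UNIV - {i}. board_rate D p Nv Qm i j t)
             - completion_rate D / min_inter_time D i * Qinter i t)) \<and>
     (\<forall>t\<in>times D.
        (\<forall>i. 0 \<le> p i t \<and> p i t \<le> price_ub D) \<and>
        (\<forall>i. idle_lb D \<le> Nv i t) \<and>
        (\<forall>i. 0 \<le> Qw i t) \<and> (\<forall>i. 0 \<le> Qm i t) \<and> (\<forall>i. 0 \<le> Qintra i t) \<and> (\<forall>i. 0 \<le> Qinter i t) \<and>
        0 \<le> fleet_size D - online_rel Nv Qm Qintra Qinter t)"

definition V_rel :: "('z::finite) fleet_data \<Rightarrow> 'z initial_state \<Rightarrow> ereal" where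
  "V_rel D X = Sup {ereal (profit_rel D p Nv Qw Qm Qintra Qinter) | p Nv Qw Qm Qintra Qinter.
                      feasible_rel D X p Nv Qw Qm Qintra Qinter}"

end

theory Submission
  imports Defs
begin

text \<open>
  A feasible solution of (P) becomes one of (R) with the same prices, idle vehicles, waiting and
  matched passengers, and with the intra-zonal part of \<open>Q\<^sup>b\<close>; only the aggregate inter-zonal
  state \<open>x\<close> has to be found. Let \<open>y\<close> be the sum of the inter-zonal components of \<open>Q\<^sup>b\<close>. The
  difference \<open>z = x - y\<close> satisfies \<open>z' = g - a z\<close>, \<open>z 0 = 0\<close>, where \<open>g \<le> 0\<close> is continuous because
  the aggregate leaves at the fastest rate \<open>a\<close>; hence \<open>z\<close> is an explicit \<open>C\<^sup>1\<close> function and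
  \<open>x \<le> y\<close>. With vehicle conservation, (R) then counts at most as many online vehicles as (P), at the
  same revenue. Nonnegativity and conservation both rest on the fact that an absolutely continuous
  function with almost everywhere nonnegative derivative is nondecreasing.
\<close>

section \<open>Absolute continuity and monotonicity from the sign of the derivative\<close>

definition nonoverlapping_intervals :: "real \<Rightarrow> real \<Rightarrow> (real \<times> real) set \<Rightarrow> bool" where
  "nonoverlapping_intervals a b S \<longleftrightarrow>
     finite S \<and> (\<forall>(u, v)\<in>S. a \<le> u \<and> u \<le> v \<and> v \<le> b) \<and>
     pairwise (\<lambda>(u, v) (u', v'). disjnt {u<..<v} {u'<..<v'}) S"

text \<open>The curried form lets the choice of \<delta> for a given e be used as a rule with two
  premises: the shape of the family and its total length.\<close>

lemma abs_continuous_on_Icc_alt: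
  "abs_continuous_on_Icc a b f \<longleftrightarrow>
     (\<forall>e>0. \<exists>d>0. \<forall>S. nonoverlapping_intervals a b S \<longrightarrow> (\<Sum>(u, v)\<in>S. v - u) < d \<longrightarrow>
        (\<Sum>(u, v)\<in>S. \<bar>f v - f u\<bar>) < e)"
  unfolding abs_continuous_on_Icc_def nonoverlapping_intervals_def by (simp only: conj_assoc imp_conjL)

text \<open>
  Cousin's lemma gives a tagged division fine for the following gauge: off the null set the
  increments over small intervals are almost nonnegative, and on it the gauge stays in an open set of
  measure below \<open>\<delta>\<close>, so that absolute continuity controls the remaining increments.
\<close>
lemma abs_continuous_on_Icc_mono_deriv:
  fixes f :: "real \<Rightarrow> real"
  assumes "a \<le> b" and ac: "abs_continuous_on_Icc a b f" and E: "negligible E"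
    and deriv: "\<And>t. t \<in> {a..b} - E \<Longrightarrow> \<exists>d\<ge>0. (f has_real_derivative d) (at t within {a..b})"
  shows "f a \<le> f b"
proof (rule field_le_epsilon)
  fix e0 :: real assume "0 < e0"
  \<comment> \<open>Good cells will lose at most \<open>e * (b - a)\<close> and bad cells at most
    \<open>e\<close>, so the total loss is \<open>e * (b - a + 1) = e0\<close>. The summand 1 also
    keeps the denominator positive when \<open>a = b\<close>.\<close>
  define e where "e = e0 / (b - a + 1)"
  have "0 < e" using \<open>0 < e0\<close> \<open>a \<le> b\<close> by (simp add: e_def)
  obtain \<delta> where "0 < \<delta>" and \<delta>: "\<And>S. \<lbrakk>nonoverlapping_intervals a b S; (\<Sum>(u, v)\<in>S. v - u) < \<delta>\<rbrakk>
      \<Longrightarrow> (\<Sum>(u, v)\<in>S. \<bar>f v - f u\<bar>) < e"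
    using ac \<open>0 < e\<close> unfolding abs_continuous_on_Icc_alt by blast
  \<comment> \<open>Since \<open>E\<close> is null, an open superset that exceeds it by less than
    \<delta> has itself measure below \<delta>.\<close>
  obtain U where "open U" "E \<subseteq> U" and mD: "U - E \<in> lmeasurable" "emeasure lebesgue (U - E) < ennreal \<delta>"
    using sets_lebesgue_outer_open[of E \<delta>] negligible_imp_sets[OF E] \<open>0 < \<delta>\<close> by blast
  have "U = (U - E) \<union> E" using \<open>E \<subseteq> U\<close> by blast
  moreover have nullE: "E \<in> null_sets lebesgue" using E by (simp add: negligible_iff_null_sets)
  ultimately have "emeasure lebesgue U = emeasure lebesgue (U - E)"
    using emeasure_Un_null_set[of "U - E" lebesgue E] mD(1) by (metis fmeasurableD)
  moreover have "U \<in> sets lebesgue" using \<open>open U\<close> by auto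
  ultimately have "U \<in> lmeasurable" and mU: "measure lebesgue U < \<delta>"
    using mD \<open>0 < \<delta>\<close>
    by (auto simp: fmeasurable_def measure_def enn2real_less_iff top_unique intro: less_trans)
  \<comment> \<open>Cells of a division are sets, so their endpoints are recovered as
    \<open>Inf\<close> and \<open>Sup\<close>.\<close>
  define good where "good K \<longleftrightarrow> f (Sup K) - f (Inf K) \<ge> - e * (Sup K - Inf K)" for K
  have "\<exists>r>0. \<forall>u v. a \<le> u \<longrightarrow> u \<le> x \<longrightarrow> x \<le> v \<longrightarrow> v \<le> b \<longrightarrow> {u..v} \<subseteq> ball x r
              \<longrightarrow> {u..v} \<subseteq> U \<or> good {u..v}" if x: "x \<in> {a..b}" for x
  proof (cases "x \<in> E")
    case True
    then show ?thesis using \<open>open U\<close> \<open>E \<subseteq> U\<close> by (meson open_contains_ball subset_iff)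
  next
    case False
    then obtain d where "d \<ge> 0" and d: "(f has_real_derivative d) (at x within {a..b})"
      using deriv x by blast
    then obtain r where "r > 0" and r: "\<And>y. \<lbrakk>y \<in> {a..b}; \<bar>y - x\<bar> < r\<rbrakk> \<Longrightarrow> \<bar>f y - f x - d * (y - x)\<bar> \<le> e * \<bar>y - x\<bar>"
      using \<open>0 < e\<close> unfolding has_field_derivative_def has_derivative_within_alt by (auto simp: mult.commute)
    \<comment> \<open>Straddle argument: the tag \<open>x\<close> lies between \<open>u\<close> and
      \<open>v\<close>, so the linear approximation at \<open>x\<close> applies to both ends. The
      linear terms contribute \<open>d * (v - u)\<close>, which is nonnegative, and the two errors
      add up to at most \<open>e * (v - u)\<close>.\<close>
    have "good {u..v}" if *: "a \<le> u" "u \<le> x" "x \<le> v" "v \<le> b" "{u..v} \<subseteq> ball x r" for u v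
    proof -
      have "u \<in> {u..v}" "v \<in> {u..v}" using * by auto
      then have "u \<in> ball x r" "v \<in> ball x r" using *(5) by (meson subsetD)+
      then have "\<bar>u - x\<bar> < r" "\<bar>v - x\<bar> < r" by (auto simp: dist_real_def)
      with r * x have "\<bar>f u - f x - d * (u - x)\<bar> \<le> e * \<bar>u - x\<bar>" "\<bar>f v - f x - d * (v - x)\<bar> \<le> e * \<bar>v - x\<bar>"
        by (metis atLeastAtMost_iff order_trans)+
      moreover have "d * (u - x) \<le> 0" "d * (v - x) \<ge> 0"
        using \<open>d \<ge> 0\<close> * by (auto simp: mult_nonneg_nonpos)
      moreover have "e * \<bar>u - x\<bar> = e * (x - u)" "e * \<bar>v - x\<bar> = e * (v - x)" using * by auto
      ultimately have "f v - f u \<ge> - (e * (x - u)) - e * (v - x)" by linarith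
      then show ?thesis using * by (simp add: good_def algebra_simps)
    qed
    then show ?thesis using \<open>r > 0\<close> by blast
  qed
  then obtain r where r: "\<And>x. x \<in> {a..b} \<Longrightarrow> r x > 0"
    "\<And>x u v. \<lbrakk>x \<in> {a..b}; a \<le> u; u \<le> x; x \<le> v; v \<le> b; {u..v} \<subseteq> ball x (r x)\<rbrakk> \<Longrightarrow> {u..v} \<subseteq> U \<or> good {u..v}"
    by metis
  \<comment> \<open>A gauge must be defined at every real. The radius 1 outside
    \<open>{a..b}\<close> is arbitrary, as all tags lie in the interval.\<close>
  define \<gamma> where "\<gamma> x = ball x (if x \<in> {a..b} then r x else 1)" for x
  have "gauge \<gamma>" unfolding \<gamma>_def using r(1) by (intro gauge_ball_dependent) auto
  then obtain p where p: "p tagged_division_of {a..b}" and fine: "\<gamma> fine p"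
    using fine_division_exists_real by blast
  define \<D> where "\<D> = snd ` p"
  have div: "\<D> division_of {a..b}" unfolding \<D>_def by (rule division_of_tagged_division[OF p])
  then have "finite \<D>" by blast
  have K: "\<exists>u v. K = {u..v} \<and> a \<le> u \<and> u \<le> v \<and> v \<le> b" if KD: "K \<in> \<D>" for K
  proof -
    obtain u v where "K = {u..v}" using division_ofD(4)[OF div KD] by (auto simp: cbox_interval)
    moreover have "K \<noteq> {}" "K \<subseteq> {a..b}" using division_ofD(2,3)[OF div KD] by auto
    ultimately show ?thesis by auto
  qed
  have cases: "K \<subseteq> U \<or> good K" if KD: "K \<in> \<D>" for K
  proof -
    obtain x where xK: "(x, K) \<in> p" using KD by (auto simp: \<D>_def)
    then have "x \<in> K" "K \<subseteq> \<gamma> x" using p fine by (auto simp: fine_def)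
    then show ?thesis using K[OF KD] r(2)[of x] by (auto simp: \<gamma>_def split: if_splits)
  qed
  \<comment> \<open>The bad cells; by \<open>cases\<close> all of them lie in
    \<open>U\<close>.\<close>
  define B where "B = {K \<in> \<D>. \<not> good K}"
  have "B \<subseteq> \<D>" by (auto simp: B_def)
  have divB: "B division_of \<Union>B" using division_of_subset[OF _ \<open>B \<subseteq> \<D>\<close>] div
    by (metis division_of_union_self)
  \<comment> \<open>Endpoint pairs of the bad cells, to which absolute continuity is applied.
    Passing to pairs loses nothing because each cell is a nonempty closed interval, determined by
    its endpoints.\<close>
  define S where "S = (\<lambda>K. (Inf K, Sup K)) ` B"
  have inj: "inj_on (\<lambda>K. (Inf K, Sup K)) B"
  proof (rule inj_onI)
    fix K L assume "K \<in> B" "L \<in> B" and eq: "(Inf K, Sup K) = (Inf L, Sup L)"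
    then have "K \<in> \<D>" "L \<in> \<D>" using \<open>B \<subseteq> \<D>\<close> by auto
    with K obtain u v u' v' where "K = {u..v}" "u \<le> v" "L = {u'..v'}" "u' \<le> v'" by metis
    with eq show "K = L" by auto
  qed
  have "(\<Sum>(u, v)\<in>S. \<bar>f v - f u\<bar>) < e"
  proof (rule \<delta>)
    have "finite S" using \<open>finite \<D>\<close> \<open>B \<subseteq> \<D>\<close> by (auto simp: S_def intro: finite_subset)
    moreover have "\<forall>(u, v)\<in>S. a \<le> u \<and> u \<le> v \<and> v \<le> b"
      using K \<open>B \<subseteq> \<D>\<close> unfolding S_def by fastforce
    moreover have "pairwise (\<lambda>(u, v) (u', v'). disjnt {u<..<v} {u'<..<v'}) S"
    proof -
      have "disjnt {Inf K<..<Sup K} {Inf L<..<Sup L}" if "K \<in> B" "L \<in> B" "K \<noteq> L" for K L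
      proof -
        have "interior K \<inter> interior L = {}" using division_ofD(5)[OF div, of K L] that \<open>B \<subseteq> \<D>\<close> by auto
        moreover have "\<exists>u v. K = {u..v} \<and> u \<le> v" "\<exists>u v. L = {u..v} \<and> u \<le> v"
          using K that \<open>B \<subseteq> \<D>\<close> by blast+
        ultimately show ?thesis by (auto simp: disjnt_def interior_atLeastAtMost_real)
      qed
      then show ?thesis unfolding S_def pairwise_def by auto
    qed
    ultimately show "nonoverlapping_intervals a b S" by (simp add: nonoverlapping_intervals_def)
    \<comment> \<open>The bad cells do not overlap, so their total length is the measure of their
      union, a subset of \<open>U\<close>.\<close>
    have "(\<Sum>(u, v)\<in>S. v - u) = (\<Sum>K\<in>B. Sup K - Inf K)"
      unfolding S_def by (subst sum.reindex[OF inj]) (simp add: o_def)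
    also have "\<dots> = (\<Sum>K\<in>B. measure lebesgue K)"
    proof (rule sum.cong[OF refl])
      fix L assume "L \<in> B"
      then obtain u v where "L = {u..v}" "u \<le> v" using K \<open>B \<subseteq> \<D>\<close> by blast
      then show "Sup L - Inf L = measure lebesgue L" by simp
    qed
    also have "\<dots> = measure lebesgue (\<Union>B)"
      using content_division[OF divB] by simp
    also have "\<dots> \<le> measure lebesgue U"
    proof (rule measure_mono_fmeasurable)
      show "\<Union>B \<subseteq> U" using cases by (auto simp: B_def)
      show "\<Union>B \<in> sets lebesgue" using lmeasurable_division[OF divB] by blast
    qed fact
    finally show "(\<Sum>(u, v)\<in>S. v - u) < \<delta>" using mU by simp
  qed
  then have B: "(\<Sum>K\<in>B. \<bar>f (Sup K) - f (Inf K)\<bar>) < e"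
    unfolding S_def by (subst (asm) sum.reindex[OF inj]) (simp add: o_def)
  \<comment> \<open>Used twice: for the identity, giving the total length, and for
    \<open>f\<close>.\<close>
  have tele: "(\<Sum>K\<in>\<D>. g (Sup K) - g (Inf K)) = g b - g a" for g :: "real \<Rightarrow> real"
  proof -
    \<comment> \<open>Dropping the tags may merge equal cells, which is harmless only if the summand
      vanishes on degenerate cells. On the empty cell this has to be forced, since
      \<open>Sup\<close> and \<open>Inf\<close> are unspecified there.\<close>
    let ?g = "\<lambda>K. if K = {} then 0 else g (Sup K) - g (Inf K)"
    have "g b - g a = (\<Sum>(x, K)\<in>p. g (Sup K) - g (Inf K))"
      using additive_tagged_division_1[OF \<open>a \<le> b\<close> p, of g] by simp
    also have "\<dots> = (\<Sum>(x, K)\<in>p. ?g K)"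
      using tagged_division_ofD(2)[OF p] by (intro sum.cong) fastforce+
    also have "\<dots> = (\<Sum>K\<in>\<D>. ?g K)"
      unfolding \<D>_def by (rule sum.over_tagged_division_lemma[OF p]) auto
    also have "\<dots> = (\<Sum>K\<in>\<D>. g (Sup K) - g (Inf K))"
      using division_ofD(3)[OF div] by (intro sum.cong) auto
    finally show ?thesis by simp
  qed
  have "- e * (b - a) = (\<Sum>K\<in>\<D>. - e * (Sup K - Inf K))"
    using tele[of "\<lambda>x. x"] by (metis sum_distrib_left)
  \<comment> \<open>Adding the absolute increment on a bad cell makes its term nonnegative, hence
    above the left-hand side.\<close>
  also have "\<dots> \<le> (\<Sum>K\<in>\<D>. (f (Sup K) - f (Inf K)) + (if good K then 0 else \<bar>f (Sup K) - f (Inf K)\<bar>))"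
  proof (rule sum_mono)
    fix L assume "L \<in> \<D>"
    then have "Inf L \<le> Sup L" using K by fastforce
    then have "e * (Sup L - Inf L) \<ge> 0" using \<open>0 < e\<close> by simp
    then show "- e * (Sup L - Inf L) \<le> (f (Sup L) - f (Inf L)) + (if good L then 0 else \<bar>f (Sup L) - f (Inf L)\<bar>)"
      by (auto simp: good_def)
  qed
  also have "\<dots> = (f b - f a) + (\<Sum>K\<in>B. \<bar>f (Sup K) - f (Inf K)\<bar>)"
    unfolding sum.distrib tele B_def
    by (simp add: sum.If_cases[OF \<open>finite \<D>\<close>] Int_def)
  finally have "f a \<le> f b + e * (b - a + 1)" using B by (simp add: algebra_simps)
  then show "f a \<le> f b + e0" using \<open>a \<le> b\<close> by (simp add: e_def)
qed

section \<open>Closure properties and sources of absolute continuity\<close>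

lemma abs_continuous_on_Icc_subinterval:
  assumes "abs_continuous_on_Icc a b f" "a \<le> c" "d \<le> b"
  shows "abs_continuous_on_Icc c d f"
proof -
  have "nonoverlapping_intervals a b S" if "nonoverlapping_intervals c d S" for S
    using that assms(2,3) unfolding nonoverlapping_intervals_def by fastforce
  then show ?thesis using assms(1) unfolding abs_continuous_on_Icc_alt by meson
qed

lemma continuous_on_abs_continuous_on_Icc:
  assumes "abs_continuous_on_Icc a b f"
  shows "continuous_on {a..b} f"
  unfolding continuous_on_iff
proof (intro ballI allI impI)
  fix x e :: real assume x: "x \<in> {a..b}" and "0 < e"
  obtain d where "0 < d" and d: "\<And>S. \<lbrakk>nonoverlapping_intervals a b S; (\<Sum>(u, v)\<in>S. v - u) < d\<rbrakk>
      \<Longrightarrow> (\<Sum>(u, v)\<in>S. \<bar>f v - f u\<bar>) < e"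
    using assms \<open>0 < e\<close> unfolding abs_continuous_on_Icc_alt by blast
  \<comment> \<open>Continuity is absolute continuity for a family consisting of a single
    interval.\<close>
  have "dist (f y) (f x) < e" if "y \<in> {a..b}" "dist y x < d" for y
    using d[of "{(min x y, max x y)}"] x that
    by (cases "x \<le> y") (auto simp: nonoverlapping_intervals_def dist_real_def abs_minus_commute)
  then show "\<exists>d>0. \<forall>y\<in>{a..b}. dist y x < d \<longrightarrow> dist (f y) (f x) < e" using \<open>0 < d\<close> by blast
qed

lemma abs_continuous_on_Icc_add:
  assumes "abs_continuous_on_Icc a b f" "abs_continuous_on_Icc a b g"
  shows "abs_continuous_on_Icc a b (\<lambda>t. f t + g t)"
  unfolding abs_continuous_on_Icc_alt
proof (intro allI impI)
  fix e :: real assume "0 < e"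
  then have "0 < e / 2" by simp
  obtain d1 where "0 < d1" and d1: "\<And>S. \<lbrakk>nonoverlapping_intervals a b S; (\<Sum>(u, v)\<in>S. v - u) < d1\<rbrakk>
      \<Longrightarrow> (\<Sum>(u, v)\<in>S. \<bar>f v - f u\<bar>) < e / 2"
    using assms(1) \<open>0 < e / 2\<close> unfolding abs_continuous_on_Icc_alt by blast
  obtain d2 where "0 < d2" and d2: "\<And>S. \<lbrakk>nonoverlapping_intervals a b S; (\<Sum>(u, v)\<in>S. v - u) < d2\<rbrakk>
      \<Longrightarrow> (\<Sum>(u, v)\<in>S. \<bar>g v - g u\<bar>) < e / 2"
    using assms(2) \<open>0 < e / 2\<close> unfolding abs_continuous_on_Icc_alt by blast
  have "(\<Sum>(u, v)\<in>S. \<bar>f v + g v - (f u + g u)\<bar>) < e"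
    if S: "nonoverlapping_intervals a b S" "(\<Sum>(u, v)\<in>S. v - u) < min d1 d2" for S
  proof -
    have "(\<Sum>(u, v)\<in>S. \<bar>f v + g v - (f u + g u)\<bar>)
        \<le> (\<Sum>(u, v)\<in>S. \<bar>f v - f u\<bar>) + (\<Sum>(u, v)\<in>S. \<bar>g v - g u\<bar>)"
      unfolding sum.distrib[symmetric] by (rule sum_mono) auto
    then show ?thesis using d1[of S] d2[of S] S by linarith
  qed
  then show "\<exists>d>0. \<forall>S. nonoverlapping_intervals a b S \<longrightarrow> (\<Sum>(u, v)\<in>S. v - u) < d \<longrightarrow>
      (\<Sum>(u, v)\<in>S. \<bar>f v + g v - (f u + g u)\<bar>) < e"
    using \<open>0 < d1\<close> \<open>0 < d2\<close> by (intro exI[of _ "min d1 d2"]) auto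
qed

lemma abs_continuous_on_Icc_uminus:
  "abs_continuous_on_Icc a b f \<Longrightarrow> abs_continuous_on_Icc a b (\<lambda>t. - f t)"
  unfolding abs_continuous_on_Icc_def by (simp add: abs_minus_commute)

lemma abs_continuous_on_Icc_lipschitz:
  assumes lip: "\<And>u v. \<lbrakk>a \<le> u; u \<le> v; v \<le> b\<rbrakk> \<Longrightarrow> \<bar>f v - f u\<bar> \<le> L * (v - u)"
  shows "abs_continuous_on_Icc a b f"
  unfolding abs_continuous_on_Icc_alt
proof (intro allI impI)
  fix e :: real assume "0 < e"
  have "(\<Sum>(u, v)\<in>S. \<bar>f v - f u\<bar>) < e"
    if S: "nonoverlapping_intervals a b S" "(\<Sum>(u, v)\<in>S. v - u) < e / (\<bar>L\<bar> + 1)" for S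
  proof -
    have "(\<Sum>(u, v)\<in>S. \<bar>f v - f u\<bar>) \<le> (\<Sum>(u, v)\<in>S. (\<bar>L\<bar> + 1) * (v - u))"
    proof (rule sum_mono, clarify)
      fix u v assume "(u, v) \<in> S"
      then have uv: "a \<le> u" "u \<le> v" "v \<le> b" using S(1) by (auto simp: nonoverlapping_intervals_def)
      have "\<bar>f v - f u\<bar> \<le> L * (v - u)" using lip uv by blast
      also have "\<dots> \<le> (\<bar>L\<bar> + 1) * (v - u)" using uv by (intro mult_right_mono) auto
      finally show "\<bar>f v - f u\<bar> \<le> (\<bar>L\<bar> + 1) * (v - u)" .
    qed
    also have "\<dots> = (\<bar>L\<bar> + 1) * (\<Sum>(u, v)\<in>S. v - u)" by (simp add: sum_distrib_left split_def)
    also have "\<dots> < e" using S(2) by (simp add: pos_less_divide_eq mult.commute add_nonneg_pos)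
    finally show ?thesis .
  qed
  then show "\<exists>d>0. \<forall>S. nonoverlapping_intervals a b S \<longrightarrow> (\<Sum>(u, v)\<in>S. v - u) < d \<longrightarrow>
      (\<Sum>(u, v)\<in>S. \<bar>f v - f u\<bar>) < e"
    using \<open>0 < e\<close> by (intro exI[of _ "e / (\<bar>L\<bar> + 1)"]) (auto intro: add_nonneg_pos)
qed

text \<open>The derivative is bounded on the compact interval, so the function is Lipschitz. This
  admits explicitly constructed functions as solutions in the sense of
  \<open>solves_ode\<close>.\<close>

lemma abs_continuous_on_Icc_C1:
  assumes deriv: "\<And>t. t \<in> {a..b} \<Longrightarrow> (f has_real_derivative f' t) (at t within {a..b})"
    and "continuous_on {a..b} f'"
  shows "abs_continuous_on_Icc a b f"
proof -
  have "bounded (f' ` {a..b})"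
    using assms(2) by (simp add: compact_continuous_image compact_imp_bounded)
  then obtain L where L: "norm (f' t) \<le> L" if "t \<in> {a..b}" for t
    unfolding bounded_iff by blast
  show ?thesis
  proof (rule abs_continuous_on_Icc_lipschitz)
    fix u v assume "a \<le> u" "u \<le> v" "v \<le> b"
    then show "\<bar>f v - f u\<bar> \<le> L * (v - u)"
      using field_differentiable_bound[of "{a..b}" f f' L v u] deriv L by auto
  qed
qed

text \<open>After its last zero a negative \<open>f\<close> would be nondecreasing.\<close>
lemma abs_continuous_on_Icc_nonneg:
  fixes f :: "real \<Rightarrow> real"
  assumes ac: "abs_continuous_on_Icc a b f" and E: "negligible E" and "0 \<le> f a" "0 \<le> c"
    and deriv: "\<And>t. t \<in> {a..b} - E \<Longrightarrow>
      \<exists>d\<ge>- c * f t. (f has_real_derivative d) (at t within {a..b})"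
    and t: "t \<in> {a..b}"
  shows "0 \<le> f t"
proof (rule ccontr)
  assume neg: "\<not> 0 \<le> f t"
  define S where "S = {s \<in> {a..t}. 0 \<le> f s}"
  have cont: "continuous_on {a..t} f"
    using continuous_on_abs_continuous_on_Icc[OF ac] continuous_on_subset t by fastforce
  have "closed S"
    using continuous_closed_preimage[OF cont, of "{0..}"] unfolding S_def vimage_def
    by (simp add: Int_def)
  moreover have "S \<noteq> {}" "bdd_above S" using t \<open>0 \<le> f a\<close> by (auto simp: S_def intro: bdd_aboveI[of _ t])
  ultimately have "Sup S \<in> S" by (rule closed_contains_Sup[rotated 2])
  \<comment> \<open>The last time up to \<open>t\<close> at which \<open>f\<close> is nonnegative;
    it is attained because \<open>S\<close> is closed.\<close>
  define t0 where "t0 = Sup S"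
  have t0: "a \<le> t0" "t0 \<le> t" "0 \<le> f t0" using \<open>Sup S \<in> S\<close> by (auto simp: S_def t0_def)
  have "f t0 \<le> f t"
  proof (rule abs_continuous_on_Icc_mono_deriv[OF t0(2)])
    show "abs_continuous_on_Icc t0 t f"
      using abs_continuous_on_Icc_subinterval[OF ac] t0 t by auto
    \<comment> \<open>The sign \<open>f s < 0\<close> is available only strictly after
      \<open>t0\<close>, so \<open>t0\<close> joins the exceptional set.\<close>
    show "negligible (insert t0 E)" using E by simp
    fix s assume s: "s \<in> {t0..t} - insert t0 E"
    have "s \<notin> S" using s cSup_upper[OF _ \<open>bdd_above S\<close>, of s] by (auto simp: t0_def)
    then have "f s < 0" using s t0 by (auto simp: S_def)
    then have "0 \<le> - c * f s" using \<open>0 \<le> c\<close> by (simp add: mult_nonneg_nonpos)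
    moreover obtain d where d: "d \<ge> - c * f s" "(f has_real_derivative d) (at s within {a..b})"
      using deriv[of s] s t t0 by auto
    moreover have "{t0..t} \<subseteq> {a..b}" using t t0 by auto
    ultimately show "\<exists>d\<ge>0. (f has_real_derivative d) (at s within {t0..t})"
      by (meson DERIV_subset order_trans)
  qed
  then show False using neg t0 by linarith
qed

section \<open>Almost-everywhere solutions of differential equations\<close>

lemma AE_lebesgue_on_negligible:
  assumes "AE t in lebesgue_on S. P t" "S \<in> sets lebesgue"
  obtains E where "negligible E" "\<And>t. t \<in> S - E \<Longrightarrow> P t"
proof -
  have "AE t in lebesgue. t \<in> S \<longrightarrow> P t"
    using assms by (subst (asm) AE_restrict_space_iff) auto
  then obtain E where "{t \<in> space lebesgue. \<not> (t \<in> S \<longrightarrow> P t)} \<subseteq> E" "E \<in> null_sets lebesgue"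
    by (auto simp: eventually_ae_filter)
  then show thesis by (intro that[of E]) (auto simp: negligible_iff_null_sets)
qed

lemma solves_ode_add:
  assumes "solves_ode D x x0 f" "solves_ode D y y0 g"
  shows "solves_ode D (\<lambda>t. x t + y t) (x0 + y0) (\<lambda>t. f t + g t)"
  using assms unfolding solves_ode_def
  by (auto intro: abs_continuous_on_Icc_add DERIV_add elim!: AE_mp)

lemma solves_ode_sum:
  assumes "finite J" "\<And>j. j \<in> J \<Longrightarrow> solves_ode D (x j) (x0 j) (f j)"
  shows "solves_ode D (\<lambda>t. \<Sum>j\<in>J. x j t) (\<Sum>j\<in>J. x0 j) (\<lambda>t. \<Sum>j\<in>J. f j t)"
  using assms
proof (induction J)
  case empty
  then show ?case
    by (auto simp: solves_ode_def intro: abs_continuous_on_Icc_lipschitz[where L = 0])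
next
  case (insert j J)
  then show ?case using solves_ode_add[of D "x j" "x0 j" "f j"] by simp
qed

lemma solves_ode_rhs_cong:
  assumes "solves_ode D x x0 f" "\<And>t. t \<in> times D \<Longrightarrow> f t = g t"
  shows "solves_ode D x x0 g"
proof -
  have "AE t in lebesgue_on (times D). (x has_real_derivative f t) (at t within times D)"
    using assms(1) by (simp add: solves_ode_def)
  then have "AE t in lebesgue_on (times D). (x has_real_derivative g t) (at t within times D)"
    using AE_space[of "lebesgue_on (times D)"]
  proof eventually_elim
    case (elim t)
    then show ?case using assms(2)[of t] by simp
  qed
  then show ?thesis using assms(1) by (simp add: solves_ode_def)
qed

lemma solves_ode_continuous: "solves_ode D x x0 f \<Longrightarrow> continuous_on (times D) x"
  by (auto simp: solves_ode_def intro: continuous_on_abs_continuous_on_Icc)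

text \<open>The typical use is a state with nonnegative inflow that empties at rate
  \<open>c\<close>; with \<open>c = 0\<close> it says that a nondecreasing state stays above its
  initial value 0.\<close>

lemma solves_ode_nonneg:
  assumes ode: "solves_ode D x x0 f" and "0 \<le> x0" "0 \<le> c"
    and f: "\<And>t. t \<in> times D \<Longrightarrow> - c * x t \<le> f t" and t: "t \<in> times D"
  shows "0 \<le> x t"
proof -
  obtain E where E: "negligible E"
    "\<And>t. t \<in> times D - E \<Longrightarrow> (x has_real_derivative f t) (at t within times D)"
    using ode AE_lebesgue_on_negligible[where S = "times D"] unfolding solves_ode_def by auto
  show ?thesis
    using ode assms(2) abs_continuous_on_Icc_nonneg[OF _ E(1) _ \<open>0 \<le> c\<close> _ t, of x] E(2) f
    unfolding solves_ode_def by blast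
qed

text \<open>Both \<open>x - x0\<close> and \<open>x0 - x\<close> start at 0 with zero derivative, so
  both are nonnegative.\<close>

lemma solves_ode_constant:
  assumes ode: "solves_ode D x x0 (\<lambda>t. 0)" and t: "t \<in> times D"
  shows "x t = x0"
proof -
  have const: "solves_ode D (\<lambda>t. k) k (\<lambda>t. 0)" for k :: real
    by (auto simp: solves_ode_def intro: abs_continuous_on_Icc_lipschitz[where L = 0])
  have neg: "solves_ode D (\<lambda>t. - x t) (- x0) (\<lambda>t. 0)"
    using ode unfolding solves_ode_def
    by (auto intro: abs_continuous_on_Icc_uminus DERIV_minus[of _ 0, simplified] elim!: AE_mp)
  have "0 \<le> x t + - x0"
    using solves_ode_nonneg[OF solves_ode_add[OF ode const[of "- x0"]], of 0 t] t by simp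
  moreover have "0 \<le> - x t + x0"
    using solves_ode_nonneg[OF solves_ode_add[OF neg const[of "x0"]], of 0 t] t by simp
  ultimately show ?thesis by simp
qed

section \<open>Aggregating damped equations at the fastest rate\<close>

text \<open>Variation of constants with integrating factor \<open>exp (a * s)\<close>. Continuity of
  \<open>g\<close> makes the derivative exist at every point and be continuous, and the sign of
  \<open>z\<close> is that of the integrand.\<close>

lemma damped_ode_nonpos_solution:
  fixes g :: "real \<Rightarrow> real"
  assumes g: "continuous_on {0..T} g" and nonpos: "\<And>t. t \<in> {0..T} \<Longrightarrow> g t \<le> 0"
  obtains z where "abs_continuous_on_Icc 0 T z" "z 0 = 0" "\<And>t. t \<in> {0..T} \<Longrightarrow> z t \<le> 0"
    "\<And>t. t \<in> {0..T} \<Longrightarrow> (z has_real_derivative g t - a * z t) (at t within {0..T})"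
proof -
  define G where "G s = exp (a * s) * g s" for s
  define z where "z t = exp (- a * t) * integral {0..t} G" for t
  have G: "continuous_on {0..T} G" unfolding G_def by (intro continuous_intros g)
  have deriv: "(z has_real_derivative g t - a * z t) (at t within {0..T})" if "t \<in> {0..T}" for t
  proof -
    have "(z has_real_derivative exp (- a * t) * (- a) * integral {0..t} G + exp (- a * t) * G t)
        (at t within {0..T})"
      unfolding z_def
      by (auto intro!: derivative_eq_intros integral_has_real_derivative[OF G that])
    moreover have "exp (- a * t) * G t = g t"
      by (simp add: G_def mult.assoc[symmetric] exp_add[symmetric])
    ultimately show ?thesis by (simp add: z_def algebra_simps)
  qed
  have "continuous_on {0..T} z"
    using deriv DERIV_continuous continuous_on_eq_continuous_within by blast
  then have "abs_continuous_on_Icc 0 T z"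
    by (intro abs_continuous_on_Icc_C1[OF deriv] continuous_intros g)
  moreover have "z t \<le> 0" if t: "t \<in> {0..T}" for t
  proof -
    have "continuous_on {0..t} G" using continuous_on_subset[OF G] t by auto
    then have "0 \<le> integral {0..t} (\<lambda>s. - G s)"
      using nonpos t by (intro integral_nonneg integrable_continuous_real continuous_intros)
        (auto simp: G_def mult_nonneg_nonpos)
    then show ?thesis by (simp add: z_def mult_nonneg_nonpos)
  qed
  moreover have "z 0 = 0" by (simp add: z_def)
  ultimately show thesis using that deriv by blast
qed

text \<open>No existence theorem is applied to the inflows \<open>b\<close>, which need not be
  continuous: the aggregate is the sum of the given solutions plus a correction \<open>z\<close>
  driven only by the continuous states \<open>y j\<close>.\<close>

lemma aggregate_damped_ode:
  fixes y b :: "'j \<Rightarrow> real \<Rightarrow> real"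
  assumes "finite J"
    and ode: "\<And>j. j \<in> J \<Longrightarrow> solves_ode D (y j) (y0 j) (\<lambda>t. b j t - c j * y j t)"
    and c: "\<And>j. j \<in> J \<Longrightarrow> c j \<le> a" and "0 \<le> a"
    and y0: "\<And>j. j \<in> J \<Longrightarrow> 0 \<le> y0 j"
    and y: "\<And>j t. \<lbrakk>j \<in> J; t \<in> times D\<rbrakk> \<Longrightarrow> 0 \<le> y j t"
    and b: "\<And>j t. \<lbrakk>j \<in> J; t \<in> times D\<rbrakk> \<Longrightarrow> 0 \<le> b j t"
  obtains x where "solves_ode D x (\<Sum>j\<in>J. y0 j) (\<lambda>t. (\<Sum>j\<in>J. b j t) - a * x t)"
    "\<And>t. t \<in> times D \<Longrightarrow> 0 \<le> x t" "\<And>t. t \<in> times D \<Longrightarrow> x t \<le> (\<Sum>j\<in>J. y j t)"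
proof -
  \<comment> \<open>Exactly the term that turns the individual outflows \<open>c j * y j t\<close>
    into the common outflow \<open>a * y j t\<close> when it is added to the summed
    equations.\<close>
  define g where "g t = (\<Sum>j\<in>J. (c j - a) * y j t)" for t
  have "continuous_on (times D) g"
    unfolding g_def by (intro continuous_intros solves_ode_continuous[OF ode])
  moreover have "g t \<le> 0" if "t \<in> times D" for t
    unfolding g_def using c y that by (intro sum_nonpos mult_nonpos_nonneg) auto
  ultimately obtain z where z: "abs_continuous_on_Icc 0 (horizon D) z" "z 0 = 0"
    "\<And>t. t \<in> times D \<Longrightarrow> z t \<le> 0"
    "\<And>t. t \<in> times D \<Longrightarrow> (z has_real_derivative g t - a * z t) (at t within times D)"
    using damped_ode_nonpos_solution by blast
  have "solves_ode D z 0 (\<lambda>t. g t - a * z t)"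
    using z AE_space[of "lebesgue_on (times D)"] by (auto simp: solves_ode_def elim!: AE_mp)
  then have "solves_ode D (\<lambda>t. (\<Sum>j\<in>J. y j t) + z t) ((\<Sum>j\<in>J. y0 j) + 0)
      (\<lambda>t. (\<Sum>j\<in>J. b j t - c j * y j t) + (g t - a * z t))"
    by (intro solves_ode_add solves_ode_sum ode \<open>finite J\<close>)
  then have x: "solves_ode D (\<lambda>t. (\<Sum>j\<in>J. y j t) + z t) (\<Sum>j\<in>J. y0 j)
      (\<lambda>t. (\<Sum>j\<in>J. b j t) - a * ((\<Sum>j\<in>J. y j t) + z t))"
    by (simp add: g_def algebra_simps sum.distrib sum_subtractf sum_distrib_left)
  show thesis
  proof (rule that[OF x])
    fix t assume t: "t \<in> times D"
    show "0 \<le> (\<Sum>j\<in>J. y j t) + z t"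
    proof (rule solves_ode_nonneg[OF x _ \<open>0 \<le> a\<close> _ t])
      fix s assume "s \<in> times D"
      then show "- a * ((\<Sum>j\<in>J. y j s) + z s) \<le> (\<Sum>j\<in>J. b j s) - a * ((\<Sum>j\<in>J. y j s) + z s)"
        using b by (simp add: sum_nonneg)
    qed (simp add: sum_nonneg y0)
    show "(\<Sum>j\<in>J. y j t) + z t \<le> (\<Sum>j\<in>J. y j t)" using z(3) t by simp
  qed
qed

section \<open>Measurability and integrability of the revenue\<close>

lemma stepwise_borel_measurable:
  assumes "stepwise D f" "0 < ctrl_period D"
  shows "f \<in> borel_measurable (lebesgue_on (times D))"
proof -
  define P where "P = ctrl_period D"
  obtain c where c: "f t = c k" if "t \<in> {real k * P..<real (k + 1) * P} \<inter> times D" for k t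
    using assms(1) unfolding stepwise_def constant_on_def P_def by metis
  \<comment> \<open>The control interval containing \<open>t\<close> has index
    \<open>k = floor (t / P)\<close>, so the function factors through a countable discrete space, on
    which every map is measurable.\<close>
  have eq: "f t = c (nat \<lfloor>t / P\<rfloor>)" if t: "t \<in> times D" for t
  proof (rule c)
    have "0 \<le> \<lfloor>t / P\<rfloor>" using t assms(2) by (simp add: P_def)
    then have "real (nat \<lfloor>t / P\<rfloor>) = of_int \<lfloor>t / P\<rfloor>" by simp
    moreover have "of_int \<lfloor>t / P\<rfloor> \<le> t / P" "t / P < of_int \<lfloor>t / P\<rfloor> + 1" by linarith+
    moreover have "of_int \<lfloor>t / P\<rfloor> * P \<le> t"
      using assms(2) by (simp add: P_def flip: pos_le_divide_eq)
    ultimately show "t \<in> {real (nat \<lfloor>t / P\<rfloor>) * P..<real (nat \<lfloor>t / P\<rfloor> + 1) * P} \<inter> times D"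
      using t assms(2) by (auto simp: P_def field_simps)
  qed
  have [measurable]: "(\<lambda>t. t) \<in> borel_measurable (lebesgue_on (times D))"
    by (intro continuous_imp_measurable_on_sets_lebesgue continuous_intros) auto
  have [measurable]: "c \<in> borel_measurable (count_space UNIV)" by simp
  have "(\<lambda>t. c (nat \<lfloor>t / P\<rfloor>)) \<in> borel_measurable (lebesgue_on (times D))"
    by measurable
  then show ?thesis
    by (subst measurable_cong[where g = "\<lambda>t. c (nat \<lfloor>t / P\<rfloor>)"]) (auto simp: eq)
qed

lemma request_rate_nonneg:
  "0 \<le> demand D i j t \<Longrightarrow> 0 \<le> request_rate D p Nv i j t"
  by (simp add: request_rate_def)

lemma board_rate_nonneg:
  assumes "\<And>j. 0 \<le> demand D i j t" "0 \<le> pickup_coeff D i" "0 \<le> Qm i t"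
  shows "0 \<le> board_rate D p Nv Qm i j t"
  unfolding board_rate_def using assms
  by (intro mult_nonneg_nonneg divide_nonneg_nonneg sum_nonneg request_rate_nonneg) auto

lemma match_rate_bounds:
  assumes "\<And>j. 0 \<le> demand D i j t" "0 \<le> Qw i t"
  shows "0 \<le> match_rate D p Nv Qw i j t" "match_rate D p Nv Qw i j t \<le> Qw i t"
proof -
  let ?r = "request_rate D p Nv i" and ?m = "min (Qw i t) (max (Nv i t - idle_lb D) 0)"
  have "0 \<le> ?r k t" for k using assms by (simp add: request_rate_nonneg)
  then have "?r j t \<le> (\<Sum>k\<in>UNIV. ?r k t)" "0 \<le> (\<Sum>k\<in>UNIV. ?r k t)" "0 \<le> ?r j t"
    by (auto intro: member_le_sum sum_nonneg)
  then have frac: "0 \<le> ?r j t / (\<Sum>k\<in>UNIV. ?r k t)" "?r j t / (\<Sum>k\<in>UNIV. ?r k t) \<le> 1"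
    by (auto simp: divide_le_eq_1)
  show "0 \<le> match_rate D p Nv Qw i j t"
    unfolding match_rate_def using assms(2) by (intro mult_nonneg_nonneg frac) auto
  have "?r j t / (\<Sum>k\<in>UNIV. ?r k t) * ?m \<le> 1 * ?m"
    using assms(2) by (intro mult_right_mono frac) auto
  also have "\<dots> \<le> Qw i t" by simp
  finally show "match_rate D p Nv Qw i j t \<le> Qw i t" unfolding match_rate_def .
qed

text \<open>Comparing the profits needs genuine integrability, because the integral of a
  nonintegrable function is 0 by convention. Prices are capped and each matching rate is at most
  \<open>Qw i t\<close>, which gives a continuous majorant.\<close>

lemma integrable_revenue_rate:
  fixes D :: "('z::finite) fleet_data"
  assumes D: "valid_data D" and p: "\<And>i. stepwise D (p i)"
    and Nv: "\<And>i. continuous_on (times D) (Nv i)" and Qw: "\<And>i. continuous_on (times D) (Qw i)"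
    and bounds: "\<And>i t. t \<in> times D \<Longrightarrow> 0 \<le> p i t \<and> p i t \<le> price_ub D \<and> 0 \<le> Qw i t"
  shows "integrable (lebesgue_on (times D)) (revenue_rate D p Nv Qw)"
proof (rule Bochner_Integration.integrable_bound)
  have dem: "0 \<le> demand D i j t" if "t \<in> times D" for i j t using D that by (auto simp: valid_data_def)
  have tau: "0 \<le> trip_time D i j" for i j using D by (auto simp: valid_data_def intro: less_imp_le)
  have "0 \<le> price_ub D" using D by (simp add: valid_data_def)
  let ?bound = "\<lambda>t. \<Sum>i\<in>UNIV. \<Sum>j\<in>UNIV. Qw i t * price_ub D * trip_time D i j"
  show "integrable (lebesgue_on (times D)) ?bound"
    by (intro continuous_imp_integrable_real continuous_intros Qw)
  have [measurable]: "p i \<in> borel_measurable (lebesgue_on (times D))" for i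
    using stepwise_borel_measurable p D by (auto simp: valid_data_def)
  have [measurable]: "demand D i j \<in> borel_measurable (lebesgue_on (times D))" for i j
    using D by (auto simp: valid_data_def)
  have [measurable]: "Nv i \<in> borel_measurable (lebesgue_on (times D))"
    "Qw i \<in> borel_measurable (lebesgue_on (times D))" for i
    by (auto intro!: continuous_imp_measurable_on_sets_lebesgue Nv Qw)
  show "revenue_rate D p Nv Qw \<in> borel_measurable (lebesgue_on (times D))"
    unfolding revenue_rate_def[abs_def] match_rate_def request_rate_def wait_time_def by measurable
  have "norm (revenue_rate D p Nv Qw t) \<le> norm (?bound t)" if t: "t \<in> times D" for t
  proof -
    have "0 \<le> match_rate D p Nv Qw i j t * p i t * trip_time D i j"
      "match_rate D p Nv Qw i j t * p i t * trip_time D i j \<le> Qw i t * price_ub D * trip_time D i j" for i j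
      using match_rate_bounds[of D i t Qw p Nv j] dem[OF t] bounds[OF t] tau \<open>0 \<le> price_ub D\<close>
      by (auto intro!: mult_mono mult_nonneg_nonneg)
    then have "0 \<le> revenue_rate D p Nv Qw t" "revenue_rate D p Nv Qw t \<le> ?bound t"
      unfolding revenue_rate_def by (intro sum_nonneg sum_mono; blast)+
    then show ?thesis by simp
  qed
  then show "AE t in lebesgue_on (times D). norm (revenue_rate D p Nv Qw t) \<le> norm (?bound t)"
    by (intro AE_I2) simp
qed

section \<open>From feasible solutions of (P) to feasible solutions of (R)\<close>

text \<open>\<open>feasible_orig\<close> contains only the dynamics, so conservation is derived. In
  the summed right-hand sides every flow occurs once with each sign; arrivals are counted by
  destination in one place and by origin in the other, hence the exchange of sums.\<close>

lemma vehicle_conservation: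
  fixes D :: "('z::finite) fleet_data"
  assumes X: "valid_initial D X"
    and feas: "feasible_orig D X p r s Qw Qm Qb Nv Nr Np" and t: "t \<in> times D"
  shows "(\<Sum>i\<in>UNIV. Nv i t) + (\<Sum>i\<in>UNIV. Qm i t) + (\<Sum>i\<in>UNIV. \<Sum>j\<in>UNIV. Qb i j t)
    + (\<Sum>i\<in>UNIV. \<Sum>j\<in>UNIV. Nr i j t) + (\<Sum>i\<in>UNIV. Np i t) = fleet_size D" (is "?W t = _")
proof -
  let ?q = "arrival_rate D Qb" and ?rr = "arrival_rate D Nr"
    and ?m = "match_rate D p Nv Qw" and ?b = "board_rate D p Nv Qm"
  have "solves_ode D ?W
     ((\<Sum>i\<in>UNIV. init_Nv X i) + (\<Sum>i\<in>UNIV. init_Qm X i) + (\<Sum>i\<in>UNIV. \<Sum>j\<in>UNIV. init_Qb X i j)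
       + (\<Sum>i\<in>UNIV. \<Sum>j\<in>UNIV. init_Nr X i j) + (\<Sum>i\<in>UNIV. init_Np X i))
     (\<lambda>t. (\<Sum>i\<in>UNIV. s i t + (\<Sum>j\<in>UNIV. ?q j i t) + (\<Sum>j\<in>UNIV. ?rr j i t)
             - (\<Sum>j\<in>UNIV. ?m i j t) - (\<Sum>j\<in>UNIV. r i j t))
       + (\<Sum>i\<in>UNIV. (\<Sum>j\<in>UNIV. ?m i j t) - (\<Sum>j\<in>UNIV. ?b i j t))
       + (\<Sum>i\<in>UNIV. \<Sum>j\<in>UNIV. ?b i j t - ?q i j t)
       + (\<Sum>i\<in>UNIV. \<Sum>j\<in>UNIV. r i j t - ?rr i j t) + (\<Sum>i\<in>UNIV. - s i t))"
    using feas unfolding feasible_orig_def by (intro solves_ode_add solves_ode_sum finite) blast+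
  moreover have "(\<Sum>i\<in>UNIV. \<Sum>j\<in>UNIV. ?q j i t) = (\<Sum>i\<in>UNIV. \<Sum>j\<in>UNIV. ?q i j t)"
    "(\<Sum>i\<in>UNIV. \<Sum>j\<in>UNIV. ?rr j i t) = (\<Sum>i\<in>UNIV. \<Sum>j\<in>UNIV. ?rr i j t)" for t
    by (rule sum.swap)+
  ultimately have "solves_ode D ?W (fleet_size D) (\<lambda>t. 0)"
    using X by (simp add: valid_initial_def sum.distrib sum_subtractf sum_negf)
  then show ?thesis using solves_ode_constant t by blast
qed

text \<open>At least two zones are required for the minimum to range over a nonempty set.\<close>

lemma min_inter_time_bounds:
  fixes D :: "('z::finite) fleet_data"
  assumes "CARD('z) \<ge> 2" "\<And>j. 0 < trip_time D i j"
  shows "0 < min_inter_time D i" "j \<noteq> i \<Longrightarrow> min_inter_time D i \<le> trip_time D i j"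
proof -
  have "UNIV - {i} \<noteq> {}"
  proof
    assume "UNIV - {i} = {}"
    then have "UNIV = {i}" by blast
    then have "CARD('z) = 1" by (metis is_singletonI is_singleton_altdef)
    then show False using assms(1) by simp
  qed
  then show "0 < min_inter_time D i" using assms(2) by (simp add: min_inter_time_def)
  show "j \<noteq> i \<Longrightarrow> min_inter_time D i \<le> trip_time D i j" by (simp add: min_inter_time_def)
qed

text \<open>The bound on online vehicles serves twice: with nonnegative parking it gives the fleet
  constraint of (R), and later it compares the operating costs.\<close>

lemma feasible_orig_imp_feasible_rel:
  fixes D :: "('z::finite) fleet_data"
  assumes card: "CARD('z) \<ge> 2" and D: "valid_data D" and X: "valid_initial D X"
    and feas: "feasible_orig D X p r s Qw Qm Qb Nv Nr Np"
  obtains Qintra Qinter where "feasible_rel D X p Nv Qw Qm Qintra Qinter"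
    "\<And>t. t \<in> times D \<Longrightarrow> online_rel Nv Qm Qintra Qinter t \<le> online_orig D Np t"
proof -
  define \<kappa> where "\<kappa> = completion_rate D"
  have "0 < \<kappa>" and tau: "\<And>i j. 0 < trip_time D i j" and beta: "\<And>i. 0 < pickup_coeff D i"
    and dem: "\<And>i j t. t \<in> times D \<Longrightarrow> 0 \<le> demand D i j t"
    using D by (auto simp: valid_data_def \<kappa>_def)
  note min_inter = min_inter_time_bounds[OF card tau]
  have Qm: "0 \<le> Qm i t" and Qb: "0 \<le> Qb i j t" and Np: "0 \<le> Np i t" and r: "0 \<le> r i j t"
    if "t \<in> times D" for i j t
    using feas that by (auto simp: feasible_orig_def)
  have Qb0: "0 \<le> init_Qb X i j" for i j using X by (simp add: valid_initial_def)
  have board: "0 \<le> board_rate D p Nv Qm i j t" if "t \<in> times D" for i j t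
    by (intro board_rate_nonneg dem Qm less_imp_le[OF beta] that)
  have Qb_ode: "solves_ode D (Qb i j) (init_Qb X i j)
      (\<lambda>t. board_rate D p Nv Qm i j t - \<kappa> / trip_time D i j * Qb i j t)" for i j
    using feas unfolding feasible_orig_def arrival_rate_def \<kappa>_def by simp
  \<comment> \<open>One predicate collects all that is needed of the aggregate of zone
    \<open>i\<close>, so that a single choice over the zones yields \<open>Qinter\<close>.\<close>
  let ?inter = "\<lambda>i x. solves_ode D x (\<Sum>j\<in>UNIV - {i}. init_Qb X i j)
        (\<lambda>t. (\<Sum>j\<in>UNIV - {i}. board_rate D p Nv Qm i j t) - \<kappa> / min_inter_time D i * x t) \<and>
      (\<forall>t\<in>times D. 0 \<le> x t \<and> x t \<le> (\<Sum>j\<in>UNIV - {i}. Qb i j t))"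
  have "\<exists>x. ?inter i x" for i
  proof (rule aggregate_damped_ode[of "UNIV - {i}" D "Qb i" "init_Qb X i" "board_rate D p Nv Qm i"
        "\<lambda>j. \<kappa> / trip_time D i j" "\<kappa> / min_inter_time D i"])
    show "\<kappa> / trip_time D i j \<le> \<kappa> / min_inter_time D i" if "j \<in> UNIV - {i}" for j
      using min_inter that tau \<open>0 < \<kappa>\<close> by (intro divide_left_mono) (auto intro: mult_pos_pos)
    show "0 \<le> \<kappa> / min_inter_time D i" using min_inter(1)[of i] \<open>0 < \<kappa>\<close> by simp
    show "\<exists>x. ?inter i x"
      if "solves_ode D x (\<Sum>j\<in>UNIV - {i}. init_Qb X i j)
          (\<lambda>t. (\<Sum>j\<in>UNIV - {i}. board_rate D p Nv Qm i j t) - \<kappa> / min_inter_time D i * x t)"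
        "\<And>t. t \<in> times D \<Longrightarrow> 0 \<le> x t" "\<And>t. t \<in> times D \<Longrightarrow> x t \<le> (\<Sum>j\<in>UNIV - {i}. Qb i j t)" for x
      using that by (intro exI[of _ x] conjI ballI)
  qed (rule finite Qb_ode Qb0 Qb board; assumption?)+
  then obtain Qinter where "\<And>i. ?inter i (Qinter i)"
    using choice[of ?inter] by blast
  then have inter_ode: "solves_ode D (Qinter i) (\<Sum>j\<in>UNIV - {i}. init_Qb X i j)
        (\<lambda>t. (\<Sum>j\<in>UNIV - {i}. board_rate D p Nv Qm i j t) - \<kappa> / min_inter_time D i * Qinter i t)"
    and inter: "t \<in> times D \<Longrightarrow> 0 \<le> Qinter i t"
      "t \<in> times D \<Longrightarrow> Qinter i t \<le> (\<Sum>j\<in>UNIV - {i}. Qb i j t)" for i t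
    by simp_all
  define Qintra where "Qintra i = Qb i i" for i
  \<comment> \<open>(P) has no sign constraint on the relocating vehicles.\<close>
  have Nr: "0 \<le> Nr i j t" if t: "t \<in> times D" for i j t
  proof (rule solves_ode_nonneg[OF _ _ _ _ t])
    show "solves_ode D (Nr i j) (init_Nr X i j) (\<lambda>t. r i j t - arrival_rate D Nr i j t)"
      using feas by (simp add: feasible_orig_def)
    show "0 \<le> init_Nr X i j" using X by (simp add: valid_initial_def)
    show "0 \<le> \<kappa> / trip_time D i j" using tau[of i j] \<open>0 < \<kappa>\<close> by simp
    show "- (\<kappa> / trip_time D i j) * Nr i j t \<le> r i j t - arrival_rate D Nr i j t"
      if "t \<in> times D" for t
      using r[OF that] by (simp add: arrival_rate_def \<kappa>_def)
  qed
  have online: "online_rel Nv Qm Qintra Qinter t \<le> online_orig D Np t" if t: "t \<in> times D" for t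
  proof -
    \<comment> \<open>The diagonal term is matched exactly and the aggregate is below the sum of the
      others. The relocating vehicles, absent from (R), are dropped below as a nonnegative
      quantity.\<close>
    have "Qintra i t + Qinter i t \<le> (\<Sum>j\<in>UNIV. Qb i j t)" for i
      using inter(2)[OF t, of i] by (simp add: Qintra_def sum.remove[of UNIV i])
    then have "(\<Sum>i\<in>UNIV. Qintra i t + Qinter i t) \<le> (\<Sum>i\<in>UNIV. \<Sum>j\<in>UNIV. Qb i j t)"
      by (rule sum_mono)
    moreover have "0 \<le> (\<Sum>i\<in>UNIV. \<Sum>j\<in>UNIV. Nr i j t)" by (intro sum_nonneg Nr t)
    ultimately show ?thesis
      using vehicle_conservation[OF X feas t]
      by (simp add: online_rel_def online_orig_def sum.distrib)
  qed
  have "online_rel Nv Qm Qintra Qinter t \<le> fleet_size D" if t: "t \<in> times D" for t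
    using online[OF t] sum_nonneg[of UNIV "\<lambda>i. Np i t"] Np[OF t] by (simp add: online_orig_def)
  moreover have "bounded (Nv i ` times D) \<and> Nv i \<in> borel_measurable (lebesgue_on (times D))" for i
  proof -
    have "continuous_on (times D) (Nv i)"
      using feas unfolding feasible_orig_def by (elim conjE) (rule solves_ode_continuous, erule spec)
    then show ?thesis
      by (simp add: compact_continuous_image compact_imp_bounded continuous_imp_measurable_on_sets_lebesgue)
  qed
  ultimately have "feasible_rel D X p Nv Qw Qm Qintra Qinter"
    using feas inter_ode inter(1) Qb_ode
    unfolding feasible_rel_def feasible_orig_def Qintra_def \<kappa>_def by simp
  then show thesis using that online by blast
qed

theorem proposition1:
  fixes D :: "('z::finite) fleet_data" and X :: "'z initial_state"
  assumes "CARD('z) \<ge> 2"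
    and "valid_data D"
    and "valid_initial D X"
  shows "V_rel D X \<ge> V_orig D X"
  unfolding V_orig_def
proof (rule Sup_least, clarify)
  fix p r s Qw Qm Qb Nv Nr Np
  assume feas: "feasible_orig D X p r s Qw Qm Qb Nv Nr Np"
  obtain Qintra Qinter where rel: "feasible_rel D X p Nv Qw Qm Qintra Qinter"
    and online: "\<And>t. t \<in> times D \<Longrightarrow> online_rel Nv Qm Qintra Qinter t \<le> online_orig D Np t"
    using feasible_orig_imp_feasible_rel[OF assms feas] by blast
  have cont: "continuous_on (times D) (Nv i)" "continuous_on (times D) (Qw i)"
    "continuous_on (times D) (Qm i)" "continuous_on (times D) (Np i)" for i
    using feas unfolding feasible_orig_def by - (elim conjE, rule solves_ode_continuous, erule spec)+
  have cont': "continuous_on (times D) (Qintra i)" "continuous_on (times D) (Qinter i)" for i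
    using rel unfolding feasible_rel_def by - (elim conjE, rule solves_ode_continuous, erule spec)+
  have rev: "integrable (lebesgue_on (times D)) (revenue_rate D p Nv Qw)"
    using feas assms(2) by (intro integrable_revenue_rate cont) (auto simp: feasible_orig_def)
  have "integrable (lebesgue_on (times D)) (online_orig D Np)"
    "integrable (lebesgue_on (times D)) (online_rel Nv Qm Qintra Qinter)"
    unfolding online_orig_def[abs_def] online_rel_def[abs_def]
    by (intro continuous_imp_integrable_real continuous_intros cont cont')+
  \<comment> \<open>Both integrands have the same revenue term, and \<open>op_cost D\<close> is
    nonnegative, so fewer online vehicles mean no less profit at each time.\<close>
  with rev have "profit_orig D p Nv Qw Np \<le> profit_rel D p Nv Qw Qm Qintra Qinter"
    unfolding profit_orig_def profit_rel_def using assms(2) online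
    by (intro integral_mono Bochner_Integration.integrable_diff integrable_mult_right diff_left_mono mult_left_mono)
      (auto simp: valid_data_def)
  then show "ereal (profit_orig D p Nv Qw Np) \<le> V_rel D X"
    unfolding V_rel_def using rel
    by (intro Sup_upper2[of "ereal (profit_rel D p Nv Qw Qm Qintra Qinter)"] CollectI exI conjI) auto
qed

end
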